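(* Let $s\ge2$ be an integer and let $\epsilon\in(0,1/3]$ and $r>0$ be real numbers. Let $k_1,\dots,k_s$ be positive integers, $q>0$ an integer, and for $i\in[s]$ let $\mathcal F_i\subset\binom{[n]}{k_i}$ be shifted families such that $|F_1\cup\dots\cup F_s|\le k_1+\dots+k_s-q$ for all $F_1\in\mathcal F_1,\dots,F_s\in\mathcal F_s$. Then there exist juntas $\mathcal J_1\subset\binom{[n]}{k_1},\dots,\mathcal J_s\subset\binom{[n]}{k_s}$ with center $[j]$ such that for each $i$ $$|\mathcal F_i\setminus\mathcal J_i|\le\Big(\frac{k_i}{n}\Big)^r\binom{n}{k_i},$$ and for any $F_1\in\mathcal J_1,\dots,F_s\in\mathcal J_s$ we have $|F_1\cup\dots\cup F_s|\le k_1+\dots+k_s-q$, provided one of the following holds: (i) $j:=\max_{i\in[s]}\Big\{\frac{4\sigma}{\epsilon^2k_i}\Big(r\log\frac{\sigma}{(1-\epsilon)k_i}+\log\frac8{\epsilon^2}\Big),\ \frac{\sigma r}{\epsilon k_i}\Big\}$ and $n\ge(1-\epsilon)^{-1}\sigma$, where $\sigma:=\sum_{i=1}^sk_i$; (ii) $j:=\frac{4s}{\epsilon^2}\Big(r\log\frac{s}{1-\epsilon}+\log\frac8{\epsilon^2}\Big)$ and $n\ge\max_{i\in[s]}(1-\epsilon)^{-1}sk_i$; (iii) for some $C\ge2$, $j:=rs\log_C(Ces)$ and $n\ge\max_{i\in[s]}Cesk_i$.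
   Context: Logarithms without a base are natural. $[m]=\{1,\dots,m\}$; for a real $j$, $[j]$ denotes $\{1,\dots,\lfloor j\rfloor\}$. $\binom{[n]}{k}$ is the family of $k$-subsets of $[n]$. A family $\mathcal F\subset\binom{[n]}{k}$ is shifted if whenever $\{x_1<\dots<x_k\}\in\mathcal F$ and $\{y_1<\dots<y_k\}\subset[n]$ with $y_i\le x_i$ for all $i$, then $\{y_1,\dots,y_k\}\in\mathcal F$. A family $\mathcal J\subset\binom{[n]}{k}$ is a junta with center $[j]$ if there is $\mathcal J^*\subset2^{[j]}$ with $\mathcal J=\{F\in\binom{[n]}{k}: F\cap[j]\in\mathcal J^*\}$. *)

theory Defs
  imports Complex_Main "HOL-Library.Ramsey"
begin

text \<open>The library's \<^const>\<open>nsets\<close> \<open>A k\<close>, written \<open>[A]\<^bsup>k\<^esup>\<close>, is the family of all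
  finite \<open>k\<close>-element subsets of \<open>A\<close>. The ground set \<open>[n]\<close> is \<open>{1..n}\<close>.\<close>

definition initial_seg :: "real \<Rightarrow> nat set" where
  "initial_seg j = {1..nat \<lfloor>j\<rfloor>}"

text \<open>The strictly increasing lists \<open>xs\<close> and \<open>ys\<close> enumerate the \<open>k\<close>-sets
  \<open>{x\<^sub>1 < \<dots> < x\<^sub>k}\<close> and \<open>{y\<^sub>1 < \<dots> < y\<^sub>k}\<close>; list positions are counted from \<open>0\<close>.\<close>

definition shifted :: "nat \<Rightarrow> nat \<Rightarrow> nat set set \<Rightarrow> bool" where
  "shifted n k \<F> \<longleftrightarrow>
     \<F> \<subseteq> nsets {1..n} k \<and>
     (\<forall>xs ys. length xs = k \<and> sorted_wrt (<) xs \<and> set xs \<in> \<F> \<and>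
              length ys = k \<and> sorted_wrt (<) ys \<and> set ys \<subseteq> {1..n} \<and>
              (\<forall>i<k. ys ! i \<le> xs ! i)
        \<longrightarrow> set ys \<in> \<F>)"

text \<open>The center is given by a real \<open>j\<close>; it is not required to lie inside \<open>{1..n}\<close>.\<close>

definition junta :: "nat \<Rightarrow> nat \<Rightarrow> real \<Rightarrow> nat set set \<Rightarrow> bool" where
  "junta n k j \<J> \<longleftrightarrow>
     (\<exists>\<J>s. \<J>s \<subseteq> Pow (initial_seg j) \<and>
            \<J> = {F \<in> nsets {1..n} k. F \<inter> initial_seg j \<in> \<J>s})"

text \<open>The bound is an inequality between integers, since its right-hand side may be negative.\<close>

definition cross_union_bounded ::
    "nat \<Rightarrow> (nat \<Rightarrow> nat) \<Rightarrow> nat \<Rightarrow> (nat \<Rightarrow> nat set set) \<Rightarrow> bool" where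
  "cross_union_bounded s k q \<F> \<longleftrightarrow>
     (\<forall>F. (\<forall>i\<in>{1..s}. F i \<in> \<F> i) \<longrightarrow>
          int (card (\<Union>i\<in>{1..s}. F i)) \<le> int (\<Sum>i\<in>{1..s}. k i) - int q)"

end

theory Submission
  imports Defs
begin

text \<open>
  Shiftedness and the union bound force every tuple \<open>F\<^sub>i \<in> \<F>\<^sub>i\<close> to satisfy
  \<open>\<Sum>\<^sub>i |F\<^sub>i \<inter> [t]| \<ge> t + q\<close> for some \<open>t\<close>. Fix weights \<open>\<beta>\<^sub>i\<close> with sum \<open>1\<close>
  (\<open>k\<^sub>i / \<sigma>\<close> in case (i), \<open>1 / s\<close> in cases (ii) and (iii)) and let \<open>\<J>\<^sub>i\<close> consist of the sets
  whose trace on \<open>[j]\<close> agrees with that of some \<open>F \<in> \<F>\<^sub>i\<close> with \<open>|F \<inter> [t]| < \<beta>\<^sub>i t\<close> for all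
  \<open>t > j\<close>. For such \<open>F\<^sub>i\<close> the inequality can only occur at some \<open>t \<le> j\<close>, where it depends on the
  traces alone, and it implies the union bound. The sets missed by \<open>\<J>\<^sub>i\<close> exceed the line
  \<open>\<beta>\<^sub>i t\<close> somewhere beyond \<open>j\<close>. Since a random \<open>k\<close>-set contains a given \<open>m\<close>-set with
  probability at most \<open>(k/n)\<^sup>m\<close>, the number of such sets is bounded by an exponential moment,
  or by a union bound in case (iii).
\<close>

section \<open>Counting \<open>k\<close>-sets that contain or largely meet a given set\<close>

lemma card_nsets: "finite A \<Longrightarrow> card (nsets A k) = card A choose k"
  by (simp add: n_subsets nsets_def finite_subset conj_commute cong: conj_cong)

text \<open>The quotient of the two binomials is the product of \<open>(k - i) / (n - i)\<close>
  over \<open>i < m\<close>, and no factor exceeds \<open>k / n\<close>. The induction strips the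
  first factor.\<close>

lemma choose_diff_le:
  assumes "m \<le> k" "k \<le> n"
  shows "real (n - m choose (k - m)) \<le> (real k / real n) ^ m * real (n choose k)"
  using assms
proof (induction m arbitrary: n k)
  case (Suc m)
  then obtain n' k' where [simp]: "n = Suc n'" "k = Suc k'"
    by (metis Suc_le_D le_trans)
  have "real (n' - m choose (k' - m)) \<le> (real k' / real n') ^ m * real (n' choose k')"
    using Suc by auto
  also have "\<dots> \<le> (real k / real n) ^ m * real (n' choose k')"
  proof (intro mult_right_mono power_mono)
    have "real k' * (real n' + 1) \<le> (real k' + 1) * real n'"
      using Suc.prems by (simp add: distrib_left distrib_right)
    then show "real k' / real n' \<le> real k / real n"
      by (cases "n' = 0") (simp_all add: divide_simps add.commute)
  qed auto
  also have "real (n' choose k') = real k / real n * real (n choose k)"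
    using arg_cong[OF Suc_times_binomial[of k' n'], of real]
    by (simp add: field_simps del: binomial_Suc_Suc)
  finally show ?case by (simp add: mult_ac)
qed simp

text \<open>Deleting \<open>M\<close> maps these sets bijectively onto the subsets of
  \<open>A - M\<close> of size \<open>k - card M\<close>; if \<open>M\<close> does not fit, there
  are none. Both tail bounds below rest on this count.\<close>

lemma card_nsets_superset_le:
  assumes "finite A" "finite M" "k \<le> card A"
  shows "real (card {F \<in> nsets A k. M \<subseteq> F})
           \<le> (real k / real (card A)) ^ card M * real (card A choose k)"
proof (cases "M \<subseteq> A \<and> card M \<le> k")
  case True
  have "bij_betw (\<lambda>F. F - M) {F \<in> nsets A k. M \<subseteq> F} (nsets (A - M) (k - card M))"
    by (rule bij_betw_byWitness[where f' = "\<lambda>F. F \<union> M"])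
       (use True assms(2) in \<open>auto simp: nsets_def card_Diff_subset card_Un_disjoint finite_subset Int_Diff\<close>,
        subst card_Un_disjoint, auto)
  then have "card {F \<in> nsets A k. M \<subseteq> F} = card A - card M choose (k - card M)"
    using True assms by (simp add: bij_betw_same_card card_nsets card_Diff_subset)
  then show ?thesis using choose_diff_le[of "card M" k "card A"] True assms by simp
next
  case False
  then have "{F \<in> nsets A k. M \<subseteq> F} = {}"
    using assms by (auto simp: nsets_def) (meson card_mono)
  then have "card {F \<in> nsets A k. M \<subseteq> F} = 0" by (metis card.empty)
  then show ?thesis by simp
qed

text \<open>Expanding the product of \<open>1 + c\<close> over \<open>T\<close> gives one term per
  subset. It serves both to expand a power over subsets and to collect such an expansion.\<close>

lemma sum_power_card_Pow:
  fixes c :: "'a :: comm_semiring_1"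
  assumes "finite T"
  shows "(\<Sum>M\<in>Pow T. c ^ card M) = (1 + c) ^ card T"
  using prod_add[OF assms, of "\<lambda>_. c" "\<lambda>_. 1"] by (simp add: add.commute)

text \<open>With \<open>x = 1 + (x - 1)\<close> the power expands over the subsets \<open>M\<close>
  of \<open>F \<inter> T\<close>; exchanging the sums leaves the number of \<open>F\<close>
  containing \<open>M\<close>. The coefficients are nonnegative because \<open>x \<ge> 1\<close>.
  The bound is the generating function of \<open>card T\<close> independent trials with success
  probability \<open>k / card A\<close>.\<close>

lemma sum_power_card_Int_le:
  assumes "finite A" "finite T" "k \<le> card A" "x \<ge> 1"
  shows "(\<Sum>F\<in>nsets A k. x ^ card (F \<inter> T))
           \<le> (1 + (x - 1) * (real k / real (card A))) ^ card T * real (card A choose k)"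
proof -
  define p N where "p = real k / real (card A)" and "N = real (card A choose k)"
  have fin: "finite (nsets A k)"
    using assms by (simp add: finite_imp_finite_nsets)
  have "(\<Sum>F\<in>nsets A k. x ^ card (F \<inter> T)) = (\<Sum>F\<in>nsets A k. \<Sum>M\<in>Pow (F \<inter> T). (x - 1) ^ card M)"
    using assms by (intro sum.cong refl, subst sum_power_card_Pow) auto
  also have "\<dots> = (\<Sum>F\<in>nsets A k. \<Sum>M | M \<in> Pow T \<and> M \<subseteq> F. (x - 1) ^ card M)"
    by (intro sum.cong refl) auto
  also have "\<dots> = (\<Sum>M\<in>Pow T. \<Sum>F | F \<in> nsets A k \<and> M \<subseteq> F. (x - 1) ^ card M)"
    using assms fin by (intro sum.swap_restrict) auto
  also have "\<dots> = (\<Sum>M\<in>Pow T. (x - 1) ^ card M * real (card {F \<in> nsets A k. M \<subseteq> F}))"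
    by (simp add: mult.commute)
  also have "\<dots> \<le> (\<Sum>M\<in>Pow T. (x - 1) ^ card M * (p ^ card M * N))"
    unfolding p_def N_def using assms
    by (intro sum_mono mult_left_mono card_nsets_superset_le) (auto intro: finite_subset)
  also have "\<dots> = (\<Sum>M\<in>Pow T. ((x - 1) * p) ^ card M) * N"
    unfolding sum_distrib_right power_mult_distrib by (simp add: mult_ac)
  finally show ?thesis
    using assms by (simp add: sum_power_card_Pow p_def N_def)
qed

text \<open>Markov's inequality for \<open>x ^ card (F \<inter> T)\<close>; the base
  \<open>x\<close> stays free so that it can be optimised later.\<close>

lemma card_Int_ge_chernoff:
  assumes "finite A" "finite T" "k \<le> card A" "x \<ge> 1"
  shows "real (card {F \<in> nsets A k. m \<le> card (F \<inter> T)}) * x ^ m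
           \<le> (1 + (x - 1) * (real k / real (card A))) ^ card T * real (card A choose k)"
proof -
  have fin: "finite (nsets A k)"
    using assms by (simp add: finite_imp_finite_nsets)
  have "real (card {F \<in> nsets A k. m \<le> card (F \<inter> T)}) * x ^ m
          = (\<Sum>F | F \<in> nsets A k \<and> m \<le> card (F \<inter> T). x ^ m)"
    by simp
  also have "\<dots> \<le> (\<Sum>F | F \<in> nsets A k \<and> m \<le> card (F \<inter> T). x ^ card (F \<inter> T))"
    using assms by (intro sum_mono power_increasing) auto
  also have "\<dots> \<le> (\<Sum>F\<in>nsets A k. x ^ card (F \<inter> T))"
    using assms fin by (intro sum_mono2) auto
  finally show ?thesis
    using sum_power_card_Int_le[OF assms] by linarith
qed

text \<open>Such an \<open>F\<close> contains some \<open>m\<close>-subset of \<open>T\<close>, so a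
  union bound over these subsets applies.\<close>

lemma card_Int_ge_union:
  assumes "finite A" "finite T" "k \<le> card A"
  shows "real (card {F \<in> nsets A k. m \<le> card (F \<inter> T)})
           \<le> real (card T choose m) * (real k / real (card A)) ^ m * real (card A choose k)"
proof -
  have "{F \<in> nsets A k. m \<le> card (F \<inter> T)} \<subseteq> (\<Union>M\<in>nsets T m. {F \<in> nsets A k. M \<subseteq> F})"
  proof clarsimp
    fix F assume "F \<in> nsets A k" "m \<le> card (F \<inter> T)"
    then obtain M where "M \<subseteq> F \<inter> T" "card M = m" "finite M"
      by (meson obtain_subset_with_card_n)
    then show "\<exists>M\<in>nsets T m. M \<subseteq> F" by (auto simp: nsets_def)
  qed
  then have "card {F \<in> nsets A k. m \<le> card (F \<inter> T)}
      \<le> card (\<Union>M\<in>nsets T m. {F \<in> nsets A k. M \<subseteq> F})"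
    using assms by (intro card_mono finite_UN_I) (auto simp: finite_imp_finite_nsets)
  also have "\<dots> \<le> (\<Sum>M\<in>nsets T m. card {F \<in> nsets A k. M \<subseteq> F})"
    using assms by (intro card_UN_le) (auto simp: finite_imp_finite_nsets)
  finally have "real (card {F \<in> nsets A k. m \<le> card (F \<inter> T)})
      \<le> (\<Sum>M\<in>nsets T m. real (card {F \<in> nsets A k. M \<subseteq> F}))"
    by (simp flip: of_nat_sum)
  also have "\<dots> \<le> (\<Sum>M\<in>nsets T m. (real k / real (card A)) ^ m * real (card A choose k))"
  proof (rule sum_mono)
    fix M assume "M \<in> nsets T m"
    then show "real (card {F \<in> nsets A k. M \<subseteq> F}) \<le> (real k / real (card A)) ^ m * real (card A choose k)"
      using card_nsets_superset_le[of A M k] assms by (auto simp: nsets_def)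
  qed
  finally show ?thesis using assms by (simp add: card_nsets mult_ac)
qed

section \<open>Elementary estimates for factorials, binomials and logarithms\<close>

text \<open>Passing from \<open>m\<close> to \<open>m + 1\<close> multiplies \<open>m ^ m\<close> by
  \<open>(m + 1) * (1 + 1 / m) ^ m \<le> (m + 1) * e\<close>. Starting with equality at
  \<open>m = 1\<close> gains a factor \<open>e\<close> over
  \<open>m! \<ge> (m / e) ^ m\<close>.\<close>

lemma fact_lower_exp:
  assumes "m \<ge> 1"
  shows "real m ^ m \<le> exp (real m - 1) * fact m"
  using assms
proof (induction m rule: dec_induct)
  case (step m)
  have m: "real m > 0" using step by simp
  have "real (Suc m) ^ Suc m = real (Suc m) * (1 + 1 / real m) ^ m * real m ^ m"
    using m by (simp add: divide_simps add.commute)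
  also have "\<dots> \<le> real (Suc m) * exp 1 * (exp (real m - 1) * fact m)"
  proof (intro mult_mono)
    have "(1 + 1 / real m) ^ m \<le> exp (1 / real m) ^ m"
      using m by (intro power_mono) (auto simp: exp_ge_add_one_self)
    also have "\<dots> = exp 1"
      using m by (simp flip: exp_of_nat_mult)
    finally show "(1 + 1 / real m) ^ m \<le> exp 1" .
  qed (use step in auto)
  also have "\<dots> = exp (real (Suc m) - 1) * fact (Suc m)"
    by (simp add: exp_diff)
  finally show ?case .
qed simp

lemma choose_mult_le_exp:
  assumes "m \<ge> 1"
  shows "real (s * m choose m) \<le> (exp 1 * real s) ^ m / exp 1"
proof -
  have "real ((s * m choose m) * fact m) \<le> real ((s * m) ^ m)"
    using binomial_fact_pow[of "s * m" m] by (simp only: of_nat_le_iff)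
  then have "real (s * m choose m) \<le> real (s * m) ^ m / fact m"
    by (simp add: pos_le_divide_eq)
  also have "\<dots> = real s ^ m * (real m ^ m / fact m)"
    by (simp add: power_mult_distrib)
  also have "\<dots> \<le> real s ^ m * exp (real m - 1)"
    using fact_lower_exp[OF assms] by (intro mult_left_mono) (auto simp: pos_divide_le_eq)
  also have "exp (real m - 1) = exp 1 ^ m / exp 1"
    by (simp add: exp_diff flip: exp_of_nat_mult)
  finally show ?thesis by (simp add: power_mult_distrib mult.commute)
qed

text \<open>The difference of the two sides vanishes at \<open>0\<close> and has derivative
  \<open>- y^2 / (1 - y)\<close>. The quadratic term is the source of the exponential decay in the
  Chernoff tail.\<close>

lemma ln_one_minus_le:
  fixes x :: real
  assumes "0 \<le> x" "x < 1"
  shows "ln (1 - x) \<le> - x - x\<^sup>2 / 2"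
proof -
  define f where "f = (\<lambda>y::real. ln (1 - y) + y + y\<^sup>2 / 2)"
  have "f x \<le> f 0"
  proof (rule DERIV_nonpos_imp_nonincreasing[OF assms(1)])
    fix y assume "0 \<le> y" "y \<le> x"
    then have "y < 1" using assms by simp
    then have "(f has_real_derivative (- (y\<^sup>2) / (1 - y))) (at y)"
      unfolding f_def by (auto intro!: derivative_eq_intros simp: divide_simps power2_eq_square algebra_simps)
    moreover have "- (y\<^sup>2) / (1 - y) \<le> 0" using \<open>y < 1\<close> by (simp add: divide_nonpos_pos)
    ultimately show "\<exists>d. (f has_real_derivative d) (at y) \<and> d \<le> 0" by blast
  qed
  then show ?thesis by (simp add: f_def)
qed

section \<open>Bounding the number of sets above a line beyond \<open>j\<close>\<close>

text \<open>A set that exceeds the line \<open>\<beta> t\<close> has at least \<open>m = \<lceil>\<beta> t\<rceil>\<close> elements up to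
  \<open>m / \<beta> \<ge> t\<close>, so it suffices to sum over \<open>m\<close> rather than over \<open>t\<close>.\<close>

lemma card_exceeding_le:
  fixes \<beta> j g c N :: real
  assumes "0 < \<beta>" "0 < j" "0 < g" "g < 1" "0 \<le> c" "0 \<le> N"
    and bound: "\<And>m. m \<ge> 1 \<Longrightarrow>
      real (card {F \<in> nsets {1..n} k. m \<le> card (F \<inter> {1..nat \<lfloor>real m / \<beta>\<rfloor>})}) \<le> c * g ^ m * N"
  shows "real (card {F \<in> nsets {1..n} k. \<exists>t. j < real t \<and> \<beta> * real t \<le> real (card (F \<inter> {1..t}))})
           \<le> c * (g powr (\<beta> * j) / (1 - g)) * N" (is "real (card ?B) \<le> _")
proof -
  define m0 where "m0 = nat \<lceil>\<beta> * j\<rceil>"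
  define E where "E = (\<lambda>m. {F \<in> nsets {1..n} k. m \<le> card (F \<inter> {1..nat \<lfloor>real m / \<beta>\<rfloor>})})"
  have \<beta>j: "0 < \<beta> * j" using assms by simp
  then have m0: "m0 \<ge> 1" "\<beta> * j \<le> real m0"
    unfolding m0_def by linarith+
  have fin: "finite (E m)" for m
    unfolding E_def by (simp add: finite_imp_finite_nsets)
  \<comment> \<open>A \<open>k\<close>-set has at most \<open>k\<close> elements in a prefix, so
    only finitely many \<open>m\<close> occur; they start at \<open>m0\<close> because
    \<open>\<beta> * t > \<beta> * j\<close>.\<close>
  have "?B \<subseteq> (\<Union>m\<in>{m0..k}. E m)"
  proof
    fix F assume "F \<in> ?B"
    then obtain t where F: "F \<in> nsets {1..n} k" and t: "j < real t" "\<beta> * real t \<le> real (card (F \<inter> {1..t}))"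
      by auto
    define m where "m = nat \<lceil>\<beta> * real t\<rceil>"
    have "\<beta> * j \<le> \<beta> * real t" using t assms by simp
    then have "m0 \<le> m" unfolding m0_def m_def by (intro nat_mono ceiling_mono)
    have "\<beta> * real t \<le> real m" unfolding m_def by linarith
    then have "real t \<le> real m / \<beta>" using assms by (simp add: pos_le_divide_eq mult.commute)
    then have "t \<le> nat \<lfloor>real m / \<beta>\<rfloor>" by (simp add: le_nat_floor)
    then have "card (F \<inter> {1..t}) \<le> card (F \<inter> {1..nat \<lfloor>real m / \<beta>\<rfloor>})"
      by (intro card_mono) auto
    moreover have m: "m \<le> card (F \<inter> {1..t})"
      using t(2) unfolding m_def by (simp add: ceiling_le_iff)
    moreover have "card (F \<inter> {1..t}) \<le> k"
      using F by (auto simp: nsets_def intro: card_mono)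
    ultimately have "F \<in> E m" "m \<in> {m0..k}"
      using F \<open>m0 \<le> m\<close> unfolding E_def by auto
    then show "F \<in> (\<Union>m\<in>{m0..k}. E m)" by blast
  qed
  then have "card ?B \<le> card (\<Union>m\<in>{m0..k}. E m)"
    using fin by (intro card_mono) auto
  also have "\<dots> \<le> (\<Sum>m\<in>{m0..k}. card (E m))"
    by (intro card_UN_le) auto
  finally have "real (card ?B) \<le> (\<Sum>m\<in>{m0..k}. real (card (E m)))"
    by (simp flip: of_nat_sum)
  also have "\<dots> \<le> (\<Sum>m\<in>{m0..k}. c * g ^ m * N)"
    unfolding E_def using m0 by (intro sum_mono bound) auto
  also have "\<dots> = c * (\<Sum>m\<in>{m0..k}. g ^ m) * N"
    by (simp add: sum_distrib_left sum_distrib_right)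
  also have "\<dots> \<le> c * (g powr (\<beta> * j) / (1 - g)) * N"
  proof (intro mult_right_mono mult_left_mono)
    \<comment> \<open>For \<open>m0 > k\<close> the sum is empty; otherwise this is the telescoped
      geometric series.\<close>
    have "(1 - g) * (\<Sum>m\<in>{m0..k}. g ^ m) \<le> g ^ m0"
      using assms by (cases "m0 \<le> k") (simp_all add: sum_gp_multiplied)
    also have "\<dots> = g powr real m0"
      using assms by (simp add: powr_realpow)
    also have "\<dots> \<le> g powr (\<beta> * j)"
      using assms m0 by (intro powr_mono') auto
    finally show "(\<Sum>m\<in>{m0..k}. g ^ m) \<le> g powr (\<beta> * j) / (1 - g)"
      using assms by (simp add: pos_le_divide_eq mult.commute)
  qed (use assms in auto)
  finally show ?thesis .
qed

text \<open>Writing \<open>y = (1 - \<epsilon>) w\<close>, one has \<open>ln g \<le> - \<epsilon>\<^sup>2 / 2 + \<epsilon> ln w\<close>: the first term yields the factor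
  \<open>((1 - \<epsilon>) \<beta>)\<^sup>r (1 - g)\<close> and the second one \<open>w\<^sup>r\<close>.\<close>

lemma chernoff_tail_estimate:
  fixes \<epsilon> r \<beta> j y :: real
  assumes "0 < \<epsilon>" "\<epsilon> \<le> 1/3" "0 < r" "0 < \<beta>" "\<beta> \<le> 1" "0 < y" "y \<le> 1 - \<epsilon>"
    and j: "j \<ge> 4 / (\<epsilon>\<^sup>2 * \<beta>) * (r * ln (1 / ((1 - \<epsilon>) * \<beta>)) + ln (8 / \<epsilon>\<^sup>2))"
  defines "g \<equiv> y * exp (1 - y)"
  shows "g < 1" and "0 < j" and "g powr (\<beta> * j) / (1 - g) \<le> (y * \<beta>) powr r"
proof -
  define w where "w = y / (1 - \<epsilon>)"
  define L where "L = ln (1 / ((1 - \<epsilon>) * \<beta>))"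
  define K where "K = ln (8 / \<epsilon>\<^sup>2)"
  have e1: "0 < 1 - \<epsilon>" using assms by simp
  have w: "0 < w" "w \<le> 1" "y = (1 - \<epsilon>) * w" using assms e1 by (auto simp: w_def)
  have lw: "ln w \<le> 0" using w by simp
  have lnw: "1 - w \<le> - ln w" using ln_le_minus_one[of w] w by simp
  have e2: "\<epsilon>\<^sup>2 \<le> 1" using assms by (simp add: power_le_one)
  have K: "K > 0" unfolding K_def using assms e2 by (intro ln_gt_zero) (simp add: divide_simps)
  have lne: "ln (1 - \<epsilon>) \<le> - \<epsilon> - \<epsilon>\<^sup>2 / 2"
    using assms by (intro ln_one_minus_le) auto
  have L_eq: "L = - ln (1 - \<epsilon>) - ln \<beta>"
    unfolding L_def using e1 assms by (simp add: ln_div ln_mult)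
  have "ln \<beta> \<le> 0" using assms by simp
  then have L: "L \<ge> \<epsilon>" using lne L_eq zero_le_power2[of \<epsilon>] by linarith
  define a where "a = \<beta> * j"
  have "\<beta> * (4 / (\<epsilon>\<^sup>2 * \<beta>) * (r * L + K)) \<le> a"
    unfolding a_def L_def K_def using j assms by (intro mult_left_mono) auto
  then have "4 / \<epsilon>\<^sup>2 * (r * L + K) \<le> a" using assms by simp
  then have a: "4 * (r * L + K) \<le> a * \<epsilon>\<^sup>2"
    using assms by (simp add: divide_simps mult.commute)
  have rL: "r * \<epsilon> \<le> r * L" using L assms by simp
  then have rL0: "0 < r * L" using assms by (meson less_le_trans mult_pos_pos)
  have "0 < a * \<epsilon>\<^sup>2" using less_le_trans[OF _ a, of 0] rL0 K by simp
  then have a0: "0 < a" using assms by (simp add: zero_less_mult_iff)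
  then show "0 < j" unfolding a_def using assms by (simp add: zero_less_mult_iff)
  have "r * \<epsilon> \<le> (a * \<epsilon>) * \<epsilon>" using a rL rL0 K by (simp add: power2_eq_square)
  \<comment> \<open>From \<open>a * \<epsilon>^2 \<ge> 4 * r * L \<ge> r * \<epsilon>\<close>. It
    lets the \<open>\<epsilon> * ln w\<close> part of \<open>ln g\<close>, multiplied by
    \<open>a\<close>, produce the full power \<open>r\<close> of \<open>w\<close>.\<close>
  then have aer: "r \<le> a * \<epsilon>" using assms by simp
  have g0: "0 < g" unfolding g_def using assms by simp
  have "ln g = ln y + (1 - y)" unfolding g_def using assms by (simp add: ln_mult)
  also have "\<dots> = ln (1 - \<epsilon>) + \<epsilon> + ln w + (1 - \<epsilon>) * (1 - w)"
  proof -
    have "ln y = ln (1 - \<epsilon>) + ln w" unfolding w(3) using w(1) e1 by (simp add: ln_mult)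
    moreover have "(1 - \<epsilon>) * (1 - w) = 1 - \<epsilon> - y" using w(3) by (simp add: right_diff_distrib)
    ultimately show ?thesis by simp
  qed
  \<comment> \<open>Here \<open>1 - w \<le> - ln w\<close> leaves the share
    \<open>\<epsilon>\<close> of \<open>ln w\<close>, while the linear \<open>\<epsilon>\<close>
    cancels against \<open>ln (1 - \<epsilon>)\<close>.\<close>
  also have "\<dots> \<le> - \<epsilon>\<^sup>2 / 2 + ln w + (1 - \<epsilon>) * (- ln w)"
    using lne lnw e1 by (intro add_mono mult_left_mono) auto
  finally have lng: "ln g \<le> - \<epsilon>\<^sup>2 / 2 + \<epsilon> * ln w" by (simp add: algebra_simps)
  have "\<epsilon> * ln w \<le> 0" using assms lw by (simp add: mult_nonneg_nonpos)
  then have lng': "ln g \<le> - (\<epsilon>\<^sup>2 / 2)" using lng by simp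
  have "g = exp (ln g)" using g0 by simp
  also have "\<dots> \<le> exp (- (\<epsilon>\<^sup>2 / 2))" using lng' by simp
  also have "\<dots> = 1 / exp (\<epsilon>\<^sup>2 / 2)" by (simp add: exp_minus inverse_eq_divide)
  also have "\<dots> \<le> 1 / (1 + \<epsilon>\<^sup>2 / 2)"
    using assms by (intro divide_left_mono) (auto simp: exp_ge_add_one_self add_pos_nonneg)
  also have "\<dots> \<le> 1 - \<epsilon>\<^sup>2 / 8"
  proof -
    have "1 \<le> (1 - \<epsilon>\<^sup>2 / 8) * (1 + \<epsilon>\<^sup>2 / 2)"
    proof -
      have "\<epsilon>\<^sup>2 * \<epsilon>\<^sup>2 \<le> \<epsilon>\<^sup>2 * 1" using e2 by (intro mult_left_mono) auto
      then have "0 \<le> 6 * \<epsilon>\<^sup>2 - \<epsilon>\<^sup>2 * \<epsilon>\<^sup>2" using zero_le_power2[of \<epsilon>] by linarith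
      also have "\<dots> = 16 * ((1 - \<epsilon>\<^sup>2 / 8) * (1 + \<epsilon>\<^sup>2 / 2) - 1)" by (simp add: field_simps)
      finally show ?thesis by simp
    qed
    moreover have "0 < 1 + \<epsilon>\<^sup>2 / 2" by (simp add: add_pos_nonneg)
    ultimately show ?thesis by (simp only: pos_divide_le_eq)
  qed
  \<comment> \<open>This lower bound for \<open>1 - g\<close> is the reason for
    \<open>8 / \<epsilon>^2\<close> in \<open>j\<close>: the factor
    \<open>exp (- K) = \<epsilon>^2 / 8\<close> will pay for the geometric series.\<close>
  finally have g1: "\<epsilon>\<^sup>2 / 8 \<le> 1 - g" by simp
  then show "g < 1" using assms zero_less_power2[of \<epsilon>] by linarith
  have "a * ln g \<le> a * (- \<epsilon>\<^sup>2 / 2 + \<epsilon> * ln w)" using lng a0 by (intro mult_left_mono) auto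
  also have "\<dots> = - (a * \<epsilon>\<^sup>2) / 2 + (a * \<epsilon>) * ln w" by (simp add: algebra_simps)
  \<comment> \<open>Multiplying \<open>r \<le> a * \<epsilon>\<close> by \<open>ln w \<le> 0\<close>
    reverses the inequality.\<close>
  also have "\<dots> \<le> - 2 * (r * L + K) + r * ln w"
    using a mult_right_mono_neg[OF aer lw] by linarith
  also have "\<dots> \<le> r * (ln w - L) - K" using rL0 K by (simp add: algebra_simps)
  also have "ln w - L = ln (y * \<beta>)"
    using w e1 assms by (simp add: L_eq ln_mult)
  finally have main: "a * ln g \<le> r * ln (y * \<beta>) - K" .
  have "g powr a = exp (a * ln g)" using g0 by (simp add: powr_def)
  also have "\<dots> \<le> exp (r * ln (y * \<beta>) - K)" using main by simp
  also have "\<dots> = (y * \<beta>) powr r * (\<epsilon>\<^sup>2 / 8)"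
    using assms by (simp add: exp_diff powr_def K_def)
  also have "\<dots> \<le> (y * \<beta>) powr r * (1 - g)" using g1 by (intro mult_left_mono) auto
  finally show "g powr (\<beta> * j) / (1 - g) \<le> (y * \<beta>) powr r"
    using \<open>g < 1\<close> unfolding a_def by (simp add: pos_divide_le_eq)
qed

text \<open>With \<open>k / n = y * \<beta>\<close>, the Chernoff bound on the prefix of length
  about \<open>m / \<beta>\<close> gives the ratio \<open>g = y * exp (1 - y)\<close> per unit of
  \<open>m\<close>, and the tail estimate sums the resulting series.\<close>

lemma card_exceeding_le_chernoff:
  fixes \<epsilon> r \<beta> j :: real
  assumes "0 < \<epsilon>" "\<epsilon> \<le> 1/3" "0 < r" "0 < \<beta>" "\<beta> \<le> 1" "0 < k" "k \<le> n"
    and p: "real k / real n \<le> (1 - \<epsilon>) * \<beta>"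
    and j: "j \<ge> 4 / (\<epsilon>\<^sup>2 * \<beta>) * (r * ln (1 / ((1 - \<epsilon>) * \<beta>)) + ln (8 / \<epsilon>\<^sup>2))"
  shows "real (card {F \<in> nsets {1..n} k. \<exists>t. j < real t \<and> \<beta> * real t \<le> real (card (F \<inter> {1..t}))})
           \<le> (real k / real n) powr r * real (n choose k)"
proof -
  define y where "y = real k / real n / \<beta>"
  define g where "g = y * exp (1 - y)"
  have y: "0 < y" "y \<le> 1 - \<epsilon>" "y * \<beta> = real k / real n"
    using assms by (auto simp: y_def pos_divide_le_eq mult_ac)
  note tail = chernoff_tail_estimate[OF assms(1-5) y(1,2) j, folded g_def]
  have g0: "0 < g" using y by (simp add: g_def)
  have "real (card {F \<in> nsets {1..n} k. m \<le> card (F \<inter> {1..nat \<lfloor>real m / \<beta>\<rfloor>})})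
          \<le> 1 * g ^ m * real (n choose k)" for m
  proof -
    \<comment> \<open>The base \<open>1 / y\<close> minimises \<open>x\<^sup>-\<^sup>1 exp ((x - 1) y)\<close>.\<close>
    let ?c = "real (card {F \<in> nsets {1..n} k. m \<le> card (F \<inter> {1..nat \<lfloor>real m / \<beta>\<rfloor>})})"
    define t where "t = nat \<lfloor>real m / \<beta>\<rfloor>"
    have t: "real t \<le> real m / \<beta>" unfolding t_def using assms by simp
    define z where "z = (1 / y - 1) * (real k / real n)"
    have z: "z = (1 - y) * \<beta>" using y(1) by (simp add: z_def flip: y(3)) (simp add: field_simps)
    have "?c * (1 / y) ^ m \<le> (1 + z) ^ t * real (n choose k)"
      using card_Int_ge_chernoff[of "{1..n}" "{1..t}" k "1 / y" m] assms y unfolding z_def t_def by simp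
    also have "\<dots> \<le> exp (1 - y) ^ m * real (n choose k)"
    proof (rule mult_right_mono)
      have "(1 + z) ^ t \<le> exp z ^ t"
        using assms y z by (intro power_mono) (auto simp: exp_ge_add_one_self)
      also have "\<dots> = exp (real t * z)" by (simp add: exp_of_nat_mult)
      also have "\<dots> \<le> exp (real m / \<beta> * z)"
        using mult_right_mono[OF t, of z] assms(2-4) y(2) z assms(1) by simp
      also have "real m / \<beta> * z = real m * (1 - y)" using assms by (simp add: z)
      finally show "(1 + z) ^ t \<le> exp (1 - y) ^ m" by (simp add: exp_of_nat_mult)
    qed auto
    finally show ?thesis
      using y(1) by (simp add: g_def power_mult_distrib power_divide field_simps)
  qed
  then have "real (card {F \<in> nsets {1..n} k. \<exists>t. j < real t \<and> \<beta> * real t \<le> real (card (F \<inter> {1..t}))})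
      \<le> 1 * (g powr (\<beta> * j) / (1 - g)) * real (n choose k)"
    using assms tail g0 by (intro card_exceeding_le) auto
  also have "\<dots> \<le> (real k / real n) powr r * real (n choose k)"
    using tail(3) unfolding y(3) by (intro mult_right_mono) auto
  finally show ?thesis .
qed

text \<open>The factor \<open>1 / e\<close> in \<open>choose_mult_le_exp\<close> absorbs the geometric series, whose ratio is at
  most \<open>1 / C \<le> 1 / 2\<close>.\<close>

lemma card_exceeding_le_union:
  fixes r j C :: real
  assumes "0 < r" "0 < s" "0 < k" "k \<le> n" "C \<ge> 2"
    and n: "real n \<ge> C * exp 1 * real s * real k"
    and j: "j \<ge> r * real s * log C (C * exp 1 * real s)"
  shows "real (card {F \<in> nsets {1..n} k. \<exists>t. j < real t \<and> 1 / real s * real t \<le> real (card (F \<inter> {1..t}))})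
           \<le> (real k / real n) powr r * real (n choose k)"
proof -
  define p where "p = real k / real n"
  define g where "g = exp 1 * real s * p"
  have p0: "0 < p" using assms by (simp add: p_def)
  then have g0: "0 < g" using assms by (simp add: g_def)
  have "C * g \<le> 1" using n assms by (simp add: g_def p_def pos_divide_le_eq mult_ac)
  then have gC: "g \<le> 1 / C" using assms by (simp add: pos_le_divide_eq mult.commute)
  also have "1 / C \<le> 1 / 2" using assms by (intro divide_left_mono) auto
  finally have g1: "g \<le> 1 / 2" .
  have lC: "0 < ln C" using assms by simp
  have ls: "0 \<le> ln (real s)" using assms by simp
  define a where "a = 1 / real s * j"
  have "r * log C (C * exp 1 * real s) \<le> a"
    using j assms by (simp add: a_def pos_le_divide_eq mult_ac)
  then have "r * log C (C * exp 1 * real s) * ln C \<le> a * ln C"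
    using lC by (intro mult_right_mono) auto
  moreover have "log C (C * exp 1 * real s) * ln C = ln C + 1 + ln (real s)"
    using lC assms by (simp add: log_def ln_mult)
  ultimately have a: "r * (ln C + 1 + ln (real s)) \<le> a * ln C"
    by (simp add: mult.assoc)
  have "r * ln C \<le> r * (ln C + 1 + ln (real s))"
    using assms ls by (intro mult_left_mono) auto
  then have "r * ln C \<le> a * ln C" using a by linarith
  then have ar: "r \<le> a" using lC by simp
  have j0: "0 < j" using less_le_trans[OF \<open>0 < r\<close> ar] \<open>0 < s\<close> by (simp add: a_def zero_less_divide_iff)
  have lng: "ln g \<le> - ln C"
    using ln_mono[OF gC g0] assms by (simp add: ln_div)
  \<comment> \<open>Write \<open>a * ln g = r * ln g + (a - r) * ln g\<close> and use
    \<open>ln g \<le> - ln C\<close> in the second term; the lower bound on \<open>a * ln C\<close>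
    then turns \<open>r * ln g\<close> into \<open>r * ln p\<close>.\<close>
  have "(a - r) * (ln g + ln C) \<le> 0"
    using ar lng by (intro mult_nonneg_nonpos) auto
  then have "a * ln g \<le> r * (ln g - (1 + ln (real s)))"
    using a by (simp add: algebra_simps)
  also have "ln g - (1 + ln (real s)) = ln p"
    using p0 assms by (simp add: g_def ln_mult)
  finally have "g powr a \<le> p powr r"
    using g0 p0 by (simp add: powr_def)
  have "real (card {F \<in> nsets {1..n} k. m \<le> card (F \<inter> {1..nat \<lfloor>real m / (1 / real s)\<rfloor>})})
          \<le> 1 / exp 1 * g ^ m * real (n choose k)" if "m \<ge> 1" for m
  proof -
    have T: "nat \<lfloor>real m / (1 / real s)\<rfloor> = s * m"
      by (simp add: mult.commute flip: of_nat_mult)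
    have "real (card {F \<in> nsets {1..n} k. m \<le> card (F \<inter> {1..s * m})})
        \<le> real (s * m choose m) * p ^ m * real (n choose k)"
      using card_Int_ge_union[of "{1..n}" "{1..s * m}" k m] assms by (simp add: p_def)
    also have "\<dots> \<le> ((exp 1 * real s) ^ m / exp 1) * p ^ m * real (n choose k)"
      using that p0 by (intro mult_right_mono choose_mult_le_exp) auto
    finally show ?thesis
      unfolding T by (simp add: g_def power_mult_distrib mult_ac)
  qed
  then have "real (card {F \<in> nsets {1..n} k. \<exists>t. j < real t \<and> 1 / real s * real t \<le> real (card (F \<inter> {1..t}))})
      \<le> 1 / exp 1 * (g powr (1 / real s * j) / (1 - g)) * real (n choose k)"
    using assms j0 g0 g1 by (intro card_exceeding_le) auto
  also have "\<dots> \<le> p powr r * real (n choose k)"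
  proof (rule mult_right_mono)
    have "(2::real) \<le> exp 1" using exp_ge_add_one_self[of 1] by simp
    then have "2 * (1 / 2) \<le> exp 1 * (1 - g)" using g1 by (intro mult_mono) auto
    then have "g powr a / (exp 1 * (1 - g)) \<le> g powr a / 1" by (intro divide_left_mono) auto
    then show "1 / exp 1 * (g powr (1 / real s * j) / (1 - g)) \<le> p powr r"
      using \<open>g powr a \<le> p powr r\<close> unfolding a_def by simp
  qed auto
  finally show ?thesis unfolding p_def .
qed

section \<open>Shifting and prefix counts\<close>

text \<open>Restates the elementwise order through prefix counts, which are easier to handle than
  sorted lists. If \<open>ys ! i > xs ! i\<close>, the prefix up to \<open>xs ! i\<close> contains
  at least \<open>i + 1\<close> elements of \<open>X\<close> but at most \<open>i\<close> of
  \<open>Y\<close>, positions being counted from \<open>0\<close>.\<close>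

lemma shiftedD:
  assumes "shifted n k \<F>" "X \<in> \<F>" "Y \<subseteq> {1..n}" "card Y = k"
    and dom: "\<And>t. card (X \<inter> {1..t}) \<le> card (Y \<inter> {1..t})"
  shows "Y \<in> \<F>"
proof -
  have "X \<in> nsets {1..n} k" using assms by (auto simp: shifted_def)
  then have X: "X \<subseteq> {1..n}" "finite X" "card X = k" by (auto simp: nsets_def)
  have Y: "finite Y" using assms(3) finite_subset by blast
  define xs ys where "xs = sorted_list_of_set X" and "ys = sorted_list_of_set Y"
  have len: "length xs = k" "length ys = k" using X assms by (auto simp: xs_def ys_def)
  have set: "set xs = X" "set ys = Y" using X Y by (auto simp: xs_def ys_def)
  have sorted: "sorted_wrt (<) xs" "sorted_wrt (<) ys" by (auto simp: xs_def ys_def)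
  have "ys ! i \<le> xs ! i" if i: "i < k" for i
  proof (rule ccontr)
    assume "\<not> ys ! i \<le> xs ! i"
    then have less: "xs ! i < ys ! i" by simp
    have "nth xs ` {..i} \<subseteq> X \<inter> {1..xs ! i}"
    proof
      fix x assume "x \<in> nth xs ` {..i}"
      then obtain l where l: "l \<le> i" "x = xs ! l" by auto
      then have "x \<in> X" using i len set by (metis le_less_trans nth_mem)
      moreover have "x \<le> xs ! i"
        using l i len sorted_wrt_nth_less[OF sorted(1), of l i] by (cases "l = i") auto
      ultimately show "x \<in> X \<inter> {1..xs ! i}" using X by auto
    qed
    moreover have "inj_on (nth xs) {..i}"
      using i len by (intro inj_on_nth) (auto simp: xs_def)
    ultimately have "Suc i \<le> card (X \<inter> {1..xs ! i})"
      using card_mono[of "X \<inter> {1..xs ! i}" "nth xs ` {..i}"] by (simp add: card_image)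
    also have "\<dots> \<le> card (Y \<inter> {1..xs ! i})" by (rule dom)
    also have "\<dots> \<le> card (nth ys ` {..<i})"
    proof (intro card_mono)
      show "Y \<inter> {1..xs ! i} \<subseteq> nth ys ` {..<i}"
      proof
        fix y assume y: "y \<in> Y \<inter> {1..xs ! i}"
        then obtain l where l: "l < k" "y = ys ! l" using set len by (metis IntD1 in_set_conv_nth)
        have "l < i"
        proof (rule ccontr)
          assume "\<not> l < i"
          then have "ys ! i \<le> ys ! l"
            using l len sorted_wrt_nth_less[OF sorted(2), of i l] by (cases "l = i") auto
          then show False using y l less by simp
        qed
        then show "y \<in> nth ys ` {..<i}" using l by auto
      qed
    qed auto
    also have "\<dots> \<le> i" using card_image_le[of "{..<i}" "nth ys"] by simp
    finally show False by simp
  qed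
  then have "set ys \<in> \<F>"
    using assms(1) unfolding shifted_def
    by (metis len set sorted assms(2,3))
  then show ?thesis using set by simp
qed

text \<open>Once the part \<open>L\<close> of \<open>F\<close> has been moved down to
  \<open>A\<close>, the remaining elements of \<open>F\<close> are placed one at a time at the least
  free point.\<close>

lemma extend_dominating:
  fixes A L F :: "nat set"
  assumes "L \<subseteq> F" "F \<subseteq> {1..n}" "A \<subseteq> {1..n}" "card A = card L"
    and "\<And>t. card (L \<inter> {1..t}) \<le> card (A \<inter> {1..t})"
  shows "\<exists>G. A \<subseteq> G \<and> G \<subseteq> {1..n} \<and> card G = card F \<and>
             (\<forall>t. card (F \<inter> {1..t}) \<le> card (G \<inter> {1..t}))"
  using assms
proof (induction "card (F - L)" arbitrary: A L)
  case 0
  have "finite F" using 0 finite_subset by blast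
  then have "L = F" using 0 by auto
  then show ?case using 0 by blast
next
  case (Suc d)
  have fin: "finite F" "finite A" "finite L"
    using Suc.prems by (meson finite_atLeastAtMost finite_subset)+
  obtain x where x: "x \<in> F - L" using Suc.hyps(2) by (metis card.empty ex_in_conv nat.distinct(1))
  define w where "w = Min ({1..n} - A)"
  have "insert x L \<subseteq> F" using x Suc.prems by auto
  then have "card (insert x L) \<le> card F" using fin by (intro card_mono) auto
  also have "card F \<le> n" using card_mono[of "{1..n}" F] Suc.prems by simp
  finally have "card A < n" using x fin Suc.prems by simp
  then have ne: "{1..n} - A \<noteq> {}"
    using fin by (metis Diff_eq_empty_iff card_atLeastAtMost card_mono diff_Suc_1 leD)
  then have w: "w \<in> {1..n} - A" unfolding w_def by (intro Min_in) auto
  have wmin: "u \<in> A" if "u \<in> {1..n}" "u < w" for u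
    using that Min_le[of "{1..n} - A" u] unfolding w_def by (metis DiffI finite_Diff finite_atLeastAtMost leD)
  have "\<exists>G. insert w A \<subseteq> G \<and> G \<subseteq> {1..n} \<and> card G = card F \<and>
             (\<forall>t. card (F \<inter> {1..t}) \<le> card (G \<inter> {1..t}))"
  proof (rule Suc.hyps(1)[where L = "insert x L"])
    have "F - L = insert x (F - insert x L)" using x by auto
    then have "card (F - L) = Suc (card (F - insert x L))"
      using fin by (metis Diff_iff card_insert_disjoint finite_Diff insertI1)
    then show "d = card (F - insert x L)" using Suc.hyps(2) by simp
    show "card (insert w A) = card (insert x L)" using w x fin Suc.prems by simp
    fix t
    show "card (insert x L \<inter> {1..t}) \<le> card (insert w A \<inter> {1..t})"
    \<comment> \<open>From \<open>w\<close> on, both counts grow by at most one and the right one by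
      exactly one; below \<open>w\<close> the set \<open>A\<close> is already full.\<close>
    proof (cases "w \<le> t")
      case True
      have "card (insert x L \<inter> {1..t}) \<le> card (insert x (L \<inter> {1..t}))"
        using fin by (intro card_mono) auto
      also have "\<dots> \<le> Suc (card (L \<inter> {1..t}))" using fin by (simp add: card_insert_if)
      also have "\<dots> \<le> Suc (card (A \<inter> {1..t}))" using Suc.prems by simp
      also have "\<dots> = card (insert w A \<inter> {1..t})" using True w fin by simp
      finally show ?thesis .
    next
      case False
      have "insert x L \<inter> {1..t} \<subseteq> insert w A \<inter> {1..t}"
      proof
        fix u assume u: "u \<in> insert x L \<inter> {1..t}"
        then have "u \<in> {1..n}" using x Suc.prems by auto
        then show "u \<in> insert w A \<inter> {1..t}" using wmin[of u] u False by auto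
      qed
      then show ?thesis using fin by (intro card_mono) auto
    qed
  qed (use w x Suc.prems in auto)
  then show ?case by blast
qed

text \<open>The disjoint union keeps multiplicities, so a sum of counts becomes the size of one
  set.\<close>

lemma sum_card_eq_card_Sigma_Int:
  assumes "finite I" "\<And>i. i \<in> I \<Longrightarrow> finite (F i)"
  shows "(\<Sum>i\<in>I. card (F i \<inter> T)) = card (Sigma I F \<inter> {p. snd p \<in> T})"
proof -
  have "Sigma I F \<inter> {p. snd p \<in> T} = Sigma I (\<lambda>i. F i \<inter> T)" by auto
  then show ?thesis using assms by (simp add: card_SigmaI)
qed

text \<open>List the elements of all \<open>F i\<close>, with multiplicity, in increasing order as
  \<open>z\<^sub>0 \<le> z\<^sub>1 \<le> \<dots>\<close>. If the claim fails for every \<open>t\<close> then \<open>z\<^sub>l \<ge> l + 2 - q\<close>, so shifting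
  replaces \<open>z\<^sub>l\<close> by \<open>l + 2 - q\<close> for all \<open>l \<ge> q - 1\<close>, and the union becomes too large.\<close>

lemma cross_union_bounded_obtain_prefix:
  fixes s n q :: nat
  assumes shifted: "\<And>i. i \<in> {1..s} \<Longrightarrow> shifted n (k i) (\<F> i)"
    and cross: "cross_union_bounded s k q \<F>" and "q > 0"
    and F: "\<And>i. i \<in> {1..s} \<Longrightarrow> F i \<in> \<F> i"
  shows "\<exists>t. (\<Sum>i\<in>{1..s}. card (F i \<inter> {1..t})) \<ge> t + q"
proof (rule ccontr)
  assume "\<not> ?thesis"
  then have small: "(\<Sum>i\<in>{1..s}. card (F i \<inter> {1..t})) < t + q" for t
    by (simp add: not_le)
  have Fn: "F i \<subseteq> {1..n}" "finite (F i)" "card (F i) = k i" if "i \<in> {1..s}" for i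
    using F[OF that] shifted[OF that] by (auto simp: shifted_def nsets_def)
  define P where "P = Sigma {1..s} F"
  have finP: "finite P" using Fn by (auto simp: P_def)
  define \<sigma> where "\<sigma> = (\<Sum>i\<in>{1..s}. k i)"
  have cardP: "card P = \<sigma>"
    unfolding P_def \<sigma>_def using Fn by (simp add: card_SigmaI)
  obtain ps where ps: "set ps = P" "distinct ps" using finite_distinct_list[OF finP] by blast
  define zs where "zs = sort_key snd ps"
  have zs: "set zs = P" "distinct zs" "sorted (map snd zs)" "length zs = \<sigma>"
    using ps cardP by (auto simp: zs_def distinct_card)
  have nthP: "zs ! l \<in> P" if "l < \<sigma>" for l using that zs by (metis nth_mem)
  \<comment> \<open>The first \<open>l + 1\<close> listed pairs have values up to
    \<open>z_l\<close>, hence \<open>l + 1 < z_l + q\<close>.\<close>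
  have z_ge: "l + 2 - q \<le> snd (zs ! l)" if l: "l < \<sigma>" for l
  proof -
    let ?t = "snd (zs ! l)"
    have "nth zs ` {..l} \<subseteq> P \<inter> {p. snd p \<in> {1..?t}}"
    proof
      fix p assume "p \<in> nth zs ` {..l}"
      then obtain m where m: "m \<le> l" "p = zs ! m" by auto
      then have "p \<in> P" using nthP l by simp
      moreover have "snd p \<le> ?t" using sorted_nth_mono[OF zs(3) m(1)] m l zs(4) by simp
      ultimately show "p \<in> P \<inter> {p. snd p \<in> {1..?t}}"
        using Fn unfolding P_def by fastforce
    qed
    moreover have "inj_on (nth zs) {..l}" using l zs by (intro inj_on_nth) auto
    ultimately have "Suc l \<le> card (P \<inter> {p. snd p \<in> {1..?t}})"
      using card_mono[of "P \<inter> {p. snd p \<in> {1..?t}}" "nth zs ` {..l}"] finP by (simp add: card_image)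
    also have "\<dots> = (\<Sum>i\<in>{1..s}. card (F i \<inter> {1..?t}))"
      unfolding P_def using Fn by (subst sum_card_eq_card_Sigma_Int) auto
    also have "\<dots> < ?t + q" by (rule small)
    finally show ?thesis by simp
  qed
  define v where "v = (\<lambda>l. l + 2 - q)"
  \<comment> \<open>From position \<open>q - 1\<close> on, the truncated subtraction in
    \<open>v\<close> is exact: \<open>v\<close> takes the values \<open>1, 2, ...\<close> once each.
    \<open>I i\<close> collects the positions whose element comes from \<open>F i\<close>.\<close>
  define I where "I = (\<lambda>i. {l \<in> {q - 1..<\<sigma>}. fst (zs ! l) = i})"
  have finI: "finite (I i)" for i by (simp add: I_def)
  have inj_v: "inj_on v {q - 1..<\<sigma>}" using \<open>q > 0\<close> by (auto simp: v_def inj_on_def)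
  have "\<exists>G. v ` I i \<subseteq> G \<and> G \<in> \<F> i" if i: "i \<in> {1..s}" for i
  proof -
    define L where "L = (\<lambda>l. snd (zs ! l)) ` I i"
    have inj_z: "inj_on (\<lambda>l. snd (zs ! l)) (I i)"
    proof (rule inj_onI)
      fix l m assume "l \<in> I i" "m \<in> I i" "snd (zs ! l) = snd (zs ! m)"
      then have "zs ! l = zs ! m" "l < \<sigma>" "m < \<sigma>" by (auto simp: I_def prod_eq_iff)
      then show "l = m" using zs by (simp add: nth_eq_iff_index_eq)
    qed
    have inj_vi: "inj_on v (I i)" using inj_v by (rule inj_on_subset) (auto simp: I_def)
    have LF: "L \<subseteq> F i"
    proof
      fix x assume "x \<in> L"
      then obtain l where "l \<in> I i" "x = snd (zs ! l)" by (auto simp: L_def)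
      then show "x \<in> F i" using nthP[of l] by (auto simp: I_def P_def)
    qed
    have v_le: "1 \<le> v l \<and> v l \<le> snd (zs ! l)" if "l \<in> I i" for l
      using that z_ge[of l] \<open>q > 0\<close> by (auto simp: v_def I_def)
    have "\<exists>G. v ` I i \<subseteq> G \<and> G \<subseteq> {1..n} \<and> card G = card (F i) \<and>
             (\<forall>t. card (F i \<inter> {1..t}) \<le> card (G \<inter> {1..t}))"
    proof (rule extend_dominating[OF LF Fn(1)[OF i]])
      show "v ` I i \<subseteq> {1..n}"
      proof
        fix y assume "y \<in> v ` I i"
        then obtain l where l: "l \<in> I i" "y = v l" by auto
        then have "snd (zs ! l) \<in> F i" using LF by (auto simp: L_def)
        then have "snd (zs ! l) \<le> n" using Fn(1)[OF i] by auto
        then show "y \<in> {1..n}" using v_le[OF l(1)] l by simp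
      qed
      show "card (v ` I i) = card L" unfolding L_def by (simp add: card_image inj_z inj_vi)
      fix t
      have "L \<inter> {1..t} \<subseteq> (\<lambda>l. snd (zs ! l)) ` {l \<in> I i. snd (zs ! l) \<le> t}"
        by (auto simp: L_def)
      then have "card (L \<inter> {1..t}) \<le> card ((\<lambda>l. snd (zs ! l)) ` {l \<in> I i. snd (zs ! l) \<le> t})"
        using finI by (intro card_mono) auto
      also have "\<dots> \<le> card {l \<in> I i. snd (zs ! l) \<le> t}"
        using finI by (intro card_image_le) auto
      \<comment> \<open>Since \<open>v l \<le> z_l\<close>, every moved element that lay in the
        prefix still lies there.\<close>
      also have "\<dots> = card (v ` {l \<in> I i. snd (zs ! l) \<le> t})"
        by (intro card_image[symmetric] inj_on_subset[OF inj_vi]) auto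
      also have "\<dots> \<le> card (v ` I i \<inter> {1..t})"
        using finI v_le by (intro card_mono) force+
      finally show "card (L \<inter> {1..t}) \<le> card (v ` I i \<inter> {1..t})" .
    qed
    then obtain G where "v ` I i \<subseteq> G" "G \<subseteq> {1..n}" "card G = k i"
      "\<And>t. card (F i \<inter> {1..t}) \<le> card (G \<inter> {1..t})" using Fn(3)[OF i] by auto
    then show ?thesis using shiftedD[OF shifted[OF i] F[OF i]] by blast
  qed
  then have "\<exists>G. \<forall>i\<in>{1..s}. v ` I i \<subseteq> G i \<and> G i \<in> \<F> i" by (intro bchoice) blast
  then obtain G where G: "\<And>i. i \<in> {1..s} \<Longrightarrow> v ` I i \<subseteq> G i" "\<And>i. i \<in> {1..s} \<Longrightarrow> G i \<in> \<F> i"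
    by blast
  have finG: "finite (\<Union>i\<in>{1..s}. G i)"
    using G(2) shifted by (fastforce simp: shifted_def nsets_def)
  have "v ` {q - 1..<\<sigma>} \<subseteq> (\<Union>i\<in>{1..s}. G i)"
  proof
    fix y assume "y \<in> v ` {q - 1..<\<sigma>}"
    then obtain l where l: "l \<in> {q - 1..<\<sigma>}" "y = v l" by auto
    then have "fst (zs ! l) \<in> {1..s}" using nthP[of l] by (auto simp: P_def)
    then show "y \<in> (\<Union>i\<in>{1..s}. G i)" using l G(1)[of "fst (zs ! l)"] by (intro UN_I[of "fst (zs ! l)"]) (auto simp: I_def)
  qed
  then have "card (v ` {q - 1..<\<sigma>}) \<le> card (\<Union>i\<in>{1..s}. G i)" using finG by (rule card_mono[rotated])
  \<comment> \<open>The union contains all values of \<open>v\<close>, which are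
    \<open>\<sigma> - q + 1\<close> in number if \<open>q \<le> \<sigma>\<close>: one more than
    allowed.\<close>
  then have "\<sigma> - (q - 1) \<le> card (\<Union>i\<in>{1..s}. G i)"
    unfolding card_image[OF inj_v] by simp
  moreover have "int (card (\<Union>i\<in>{1..s}. G i)) \<le> int \<sigma> - int q"
    using cross G(2) unfolding cross_union_bounded_def \<sigma>_def by blast
  ultimately show False using \<open>q > 0\<close> by linarith
qed

text \<open>The prefix contributes at most \<open>t\<close> to the union but at least
  \<open>t + q\<close> to the sum of the sizes, so \<open>q\<close> is lost to repetition. The
  hypothesis sees only the traces on the prefix.\<close>

lemma card_UN_le_of_prefix:
  fixes s t q :: nat
  assumes "\<And>i. i \<in> {1..s} \<Longrightarrow> finite (F i) \<and> card (F i) = k i"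
    and "(\<Sum>i\<in>{1..s}. card (F i \<inter> {1..t})) \<ge> t + q"
  shows "int (card (\<Union>i\<in>{1..s}. F i)) \<le> int (\<Sum>i\<in>{1..s}. k i) - int q"
proof -
  have fin: "finite (F i)" if "i \<in> {1..s}" for i using assms(1) that by blast
  have "card (\<Union>i\<in>{1..s}. F i) \<le> card ({1..t} \<union> (\<Union>i\<in>{1..s}. F i - {1..t}))"
    using fin by (intro card_mono) auto
  also have "\<dots> \<le> t + card (\<Union>i\<in>{1..s}. F i - {1..t})"
    using card_Un_le[of "{1..t}" "\<Union>i\<in>{1..s}. F i - {1..t}"] by (simp del: UN_simps)
  also have "card (\<Union>i\<in>{1..s}. F i - {1..t}) \<le> (\<Sum>i\<in>{1..s}. card (F i - {1..t}))"
    by (intro card_UN_le) auto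
  finally have "card (\<Union>i\<in>{1..s}. F i) \<le> t + (\<Sum>i\<in>{1..s}. card (F i - {1..t}))"
    by simp
  moreover have "(\<Sum>i\<in>{1..s}. k i) = (\<Sum>i\<in>{1..s}. card (F i - {1..t})) + (\<Sum>i\<in>{1..s}. card (F i \<inter> {1..t}))"
  proof -
    have "k i = card (F i - {1..t}) + card (F i \<inter> {1..t})" if "i \<in> {1..s}" for i
      using assms(1)[OF that] card_Int_Diff[of "F i" "{1..t}"] by simp
    then show ?thesis by (simp flip: sum.distrib)
  qed
  ultimately show ?thesis using assms(2) by linarith
qed

section \<open>Building the juntas and choosing the weights\<close>

text \<open>Reduces the theorem to a choice of weights and a count of the sets that reach the line
  beyond \<open>j\<close>.\<close>

lemma junta_approximation:
  fixes j :: real and \<beta> :: "nat \<Rightarrow> real"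
  assumes shifted: "\<And>i. i \<in> {1..s} \<Longrightarrow> shifted n (k i) (\<F> i)"
    and cross: "cross_union_bounded s k q \<F>" and q: "q > 0"
    and \<beta>: "(\<Sum>i\<in>{1..s}. \<beta> i) \<le> 1"
    and bound: "\<And>i. i \<in> {1..s} \<Longrightarrow>
      real (card {F \<in> nsets {1..n} (k i). \<exists>t. j < real t \<and> \<beta> i * real t \<le> real (card (F \<inter> {1..t}))})
        \<le> b i"
  shows "\<exists>\<J>. (\<forall>i\<in>{1..s}. junta n (k i) j (\<J> i)) \<and>
             (\<forall>i\<in>{1..s}. real (card (\<F> i - \<J> i)) \<le> b i) \<and>
             cross_union_bounded s k q \<J>"
proof -
  define bad where "bad = (\<lambda>i F. \<exists>t. j < real t \<and> \<beta> i * real t \<le> real (card (F \<inter> {1..t})))"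
  define c where "c = nat \<lfloor>j\<rfloor>"
  have seg: "initial_seg j = {1..c}" by (simp add: initial_seg_def c_def)
  define \<J>s where "\<J>s = (\<lambda>i. (\<lambda>F. F \<inter> {1..c}) ` {F \<in> \<F> i. \<not> bad i F})"
  define \<J> where "\<J> = (\<lambda>i. {F \<in> nsets {1..n} (k i). F \<inter> {1..c} \<in> \<J>s i})"
  have sub: "\<F> i \<subseteq> nsets {1..n} (k i)" if "i \<in> {1..s}" for i
    using shifted[OF that] by (simp add: shifted_def)
  have "junta n (k i) j (\<J> i)" for i
    unfolding junta_def seg \<J>_def by (intro exI[of _ "\<J>s i"]) (auto simp: \<J>s_def)
  moreover have "real (card (\<F> i - \<J> i)) \<le> b i" if i: "i \<in> {1..s}" for i
  proof -
    \<comment> \<open>A set of \<open>\<F> i\<close> that is not bad puts its own trace into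
      \<open>\<J>s i\<close> and hence lies in \<open>\<J> i\<close>.\<close>
    have "\<F> i - \<J> i \<subseteq> {F \<in> nsets {1..n} (k i). bad i F}"
      using sub[OF i] by (auto simp: \<J>_def \<J>s_def)
    then have "card (\<F> i - \<J> i) \<le> card {F \<in> nsets {1..n} (k i). bad i F}"
      by (intro card_mono) (auto simp: finite_imp_finite_nsets)
    then show ?thesis using bound[OF i] unfolding bad_def by linarith
  qed
  moreover have "cross_union_bounded s k q \<J>"
    unfolding cross_union_bounded_def
  proof (intro allI impI)
    fix F assume F: "\<forall>i\<in>{1..s}. F i \<in> \<J> i"
    \<comment> \<open>Each \<open>F i\<close> is exchanged for a good member of
      \<open>\<F> i\<close> with the same trace, to which the prefix inequality applies.\<close>
    then have "\<forall>i\<in>{1..s}. \<exists>H. H \<in> \<F> i \<and> \<not> bad i H \<and> F i \<inter> {1..c} = H \<inter> {1..c}"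
      by (auto simp: \<J>_def \<J>s_def)
    from bchoice[OF this] obtain H where
      H: "\<And>i. i \<in> {1..s} \<Longrightarrow> H i \<in> \<F> i" "\<And>i. i \<in> {1..s} \<Longrightarrow> \<not> bad i (H i)"
        "\<And>i. i \<in> {1..s} \<Longrightarrow> F i \<inter> {1..c} = H i \<inter> {1..c}" by blast
    obtain t where t: "(\<Sum>i\<in>{1..s}. card (H i \<inter> {1..t})) \<ge> t + q"
      using cross_union_bounded_obtain_prefix[OF shifted cross q H(1)] by blast
    have "t \<le> c"
    proof (rule ccontr)
      assume "\<not> t \<le> c"
      then have "j < real t" unfolding c_def by linarith
      then have "real (\<Sum>i\<in>{1..s}. card (H i \<inter> {1..t})) \<le> (\<Sum>i\<in>{1..s}. \<beta> i * real t)"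
        unfolding of_nat_sum using H(2) by (intro sum_mono) (auto simp: bad_def not_le intro: less_imp_le)
      also have "\<dots> = (\<Sum>i\<in>{1..s}. \<beta> i) * real t" by (simp add: sum_distrib_right)
      also have "\<dots> \<le> real t" using mult_right_mono[OF \<beta>, of "real t"] by simp
      finally have "(\<Sum>i\<in>{1..s}. card (H i \<inter> {1..t})) \<le> t" by (simp only: of_nat_le_iff)
      then show False using t q by linarith
    qed
    have "F i \<inter> {1..t} = H i \<inter> {1..t}" if "i \<in> {1..s}" for i
    proof -
      have "F i \<inter> {1..t} = (F i \<inter> {1..c}) \<inter> {1..t}" using \<open>t \<le> c\<close> by auto
      also have "\<dots> = H i \<inter> {1..t}" unfolding H(3)[OF that] using \<open>t \<le> c\<close> by auto
      finally show ?thesis .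
    qed
    then have "(\<Sum>i\<in>{1..s}. card (F i \<inter> {1..t})) = (\<Sum>i\<in>{1..s}. card (H i \<inter> {1..t}))"
      by (intro sum.cong) auto
    with t have t': "(\<Sum>i\<in>{1..s}. card (F i \<inter> {1..t})) \<ge> t + q" by simp
    have "finite (F i) \<and> card (F i) = k i" if "i \<in> {1..s}" for i
      using F that by (auto simp: \<J>_def nsets_def)
    from card_UN_le_of_prefix[OF this t']
    show "int (card (\<Union>i\<in>{1..s}. F i)) \<le> int (\<Sum>i\<in>{1..s}. k i) - int q" .
  qed
  ultimately show ?thesis by blast
qed

theorem theorem3p3:
  fixes s n q :: nat and \<epsilon> r j :: real and k :: "nat \<Rightarrow> nat"
    and \<F> :: "nat \<Rightarrow> nat set set" and \<sigma> :: real
  assumes "s \<ge> 2"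
    and "0 < \<epsilon>" and "\<epsilon> \<le> 1/3" and "r > 0"
    and "\<forall>i\<in>{1..s}. k i > 0" and "q > 0"
    and "\<forall>i\<in>{1..s}. shifted n (k i) (\<F> i)"
    and "cross_union_bounded s k q \<F>"
    and "\<sigma> = (\<Sum>i\<in>{1..s}. real (k i))"
    and "(j = Max (\<Union>i\<in>{1..s}.
                {4 * \<sigma> / (\<epsilon>^2 * real (k i)) *
                   (r * ln (\<sigma> / ((1 - \<epsilon>) * real (k i))) + ln (8 / \<epsilon>^2)),
                 \<sigma> * r / (\<epsilon> * real (k i))}) \<and>
          real n \<ge> inverse (1 - \<epsilon>) * \<sigma>)
       \<or> (j = 4 * real s / \<epsilon>^2 * (r * ln (real s / (1 - \<epsilon>)) + ln (8 / \<epsilon>^2)) \<and>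
          real n \<ge> Max ((\<lambda>i. inverse (1 - \<epsilon>) * real s * real (k i)) ` {1..s}))
       \<or> (\<exists>C::real. C \<ge> 2 \<and>
          j = r * real s * log C (C * exp 1 * real s) \<and>
          real n \<ge> Max ((\<lambda>i. C * exp 1 * real s * real (k i)) ` {1..s}))"
  shows "\<exists>\<J> :: nat \<Rightarrow> nat set set.
           (\<forall>i\<in>{1..s}. junta n (k i) j (\<J> i)) \<and>
           (\<forall>i\<in>{1..s}. real (card (\<F> i - \<J> i))
               \<le> (real (k i) / real n) powr r * real (n choose k i)) \<and>
           cross_union_bounded s k q \<J>"
proof -
  have s: "s \<ge> 2" and \<epsilon>: "0 < \<epsilon>" "\<epsilon> \<le> 1/3" and r: "r > 0" and q: "q > 0"
    and kpos: "\<And>i. i \<in> {1..s} \<Longrightarrow> k i > 0"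
    and sh: "\<And>i. i \<in> {1..s} \<Longrightarrow> shifted n (k i) (\<F> i)"
    and cross: "cross_union_bounded s k q \<F>"
    and \<sigma>: "\<sigma> = (\<Sum>i\<in>{1..s}. real (k i))"
    using assms(1-9) by auto
  have e1: "0 < 1 - \<epsilon>" "1 - \<epsilon> \<le> 1" using \<epsilon> by auto
  have sum_inv: "(\<Sum>i\<in>{1..s}. 1 / real s) \<le> 1" using s by simp
  have junta: ?thesis
    if "(\<Sum>i\<in>{1..s}. \<beta> i) \<le> 1"
      and "\<And>i. i \<in> {1..s} \<Longrightarrow>
        real (card {F \<in> nsets {1..n} (k i). \<exists>t. j < real t \<and> \<beta> i * real t \<le> real (card (F \<inter> {1..t}))})
          \<le> (real (k i) / real n) powr r * real (n choose k i)"
    for \<beta> :: "nat \<Rightarrow> real"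
    using junta_approximation[of s n k \<F> q \<beta> j "\<lambda>i. (real (k i) / real n) powr r * real (n choose k i)"]
      sh cross q that by blast
  from assms(10) show ?thesis
  proof (elim disjE exE conjE)
    assume j: "j = Max (\<Union>i\<in>{1..s}.
                {4 * \<sigma> / (\<epsilon>^2 * real (k i)) *
                   (r * ln (\<sigma> / ((1 - \<epsilon>) * real (k i))) + ln (8 / \<epsilon>^2)),
                 \<sigma> * r / (\<epsilon> * real (k i))})"
      and n: "real n \<ge> inverse (1 - \<epsilon>) * \<sigma>"
    have k\<sigma>: "real (k i) \<le> \<sigma>" if "i \<in> {1..s}" for i
      unfolding \<sigma> using that by (intro member_le_sum) auto
    have "\<sigma> > 0" using k\<sigma>[of 1] kpos[of 1] s by force
    have n': "\<sigma> \<le> (1 - \<epsilon>) * real n"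
      using n e1 by (simp add: inverse_eq_divide pos_divide_le_eq mult.commute)
    also have "\<dots> \<le> real n" using e1 by (simp add: mult_left_le_one_le)
    finally have \<sigma>n: "\<sigma> \<le> real n" .
    show ?thesis
    \<comment> \<open>For this weight \<open>1 / \<beta> = \<sigma> / k i\<close>, so the
      requirement on \<open>j\<close> is the first entry for \<open>i\<close> in the maximum, and
      \<open>n \<ge> \<sigma> / (1 - \<epsilon>)\<close> says
      \<open>k i / n \<le> (1 - \<epsilon>) * \<beta>\<close>.\<close>
    proof (rule junta[where \<beta> = "\<lambda>i. real (k i) / \<sigma>"])
      show "(\<Sum>i\<in>{1..s}. real (k i) / \<sigma>) \<le> 1"
        using \<open>\<sigma> > 0\<close> unfolding sum_divide_distrib[symmetric] \<sigma>[symmetric] by simp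
    next
      fix i assume i: "i \<in> {1..s}"
      show "real (card {F \<in> nsets {1..n} (k i). \<exists>t. j < real t \<and> real (k i) / \<sigma> * real t \<le> real (card (F \<inter> {1..t}))})
          \<le> (real (k i) / real n) powr r * real (n choose k i)"
      proof (rule card_exceeding_le_chernoff[OF \<epsilon> r])
        show "k i \<le> n" using k\<sigma>[OF i] \<sigma>n by linarith
        have "real (k i) * \<sigma> \<le> real (k i) * ((1 - \<epsilon>) * real n)"
          using n' by (intro mult_left_mono) auto
        then show "real (k i) / real n \<le> (1 - \<epsilon>) * (real (k i) / \<sigma>)"
          using \<open>\<sigma> > 0\<close> \<sigma>n by (simp add: divide_simps mult_ac)
        have "4 * \<sigma> / (\<epsilon>^2 * real (k i)) * (r * ln (\<sigma> / ((1 - \<epsilon>) * real (k i))) + ln (8 / \<epsilon>^2)) \<le> j"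
          unfolding j using i by (intro Max_ge) auto
        then show "4 / (\<epsilon>\<^sup>2 * (real (k i) / \<sigma>)) * (r * ln (1 / ((1 - \<epsilon>) * (real (k i) / \<sigma>))) + ln (8 / \<epsilon>\<^sup>2)) \<le> j"
          by simp
      qed (use kpos[OF i] k\<sigma>[OF i] \<open>\<sigma> > 0\<close> in auto)
    qed
  next
    assume j: "j = 4 * real s / \<epsilon>^2 * (r * ln (real s / (1 - \<epsilon>)) + ln (8 / \<epsilon>^2))"
      and n: "real n \<ge> Max ((\<lambda>i. inverse (1 - \<epsilon>) * real s * real (k i)) ` {1..s})"
    show ?thesis
    proof (rule junta[where \<beta> = "\<lambda>_. 1 / real s", OF sum_inv])
      fix i assume i: "i \<in> {1..s}"
      have "inverse (1 - \<epsilon>) * real s * real (k i) \<le> real n"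
        using n i by (subst (asm) Max_le_iff) auto
      then have n': "real s * real (k i) \<le> (1 - \<epsilon>) * real n"
        using e1 by (simp add: inverse_eq_divide pos_divide_le_eq mult.commute)
      have "real (k i) \<le> real s * real (k i)" using s by (simp add: mult_le_cancel_right1)
      also note n'
      also have "(1 - \<epsilon>) * real n \<le> real n" using e1 by (simp add: mult_left_le_one_le)
      finally have kn: "k i \<le> n" by simp
      show "real (card {F \<in> nsets {1..n} (k i). \<exists>t. j < real t \<and> 1 / real s * real t \<le> real (card (F \<inter> {1..t}))})
          \<le> (real (k i) / real n) powr r * real (n choose k i)"
      proof (rule card_exceeding_le_chernoff[OF \<epsilon> r])
        show "real (k i) / real n \<le> (1 - \<epsilon>) * (1 / real s)"
          using n' s kn kpos[OF i] by (simp add: divide_simps mult_ac)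
        show "4 / (\<epsilon>\<^sup>2 * (1 / real s)) * (r * ln (1 / ((1 - \<epsilon>) * (1 / real s))) + ln (8 / \<epsilon>\<^sup>2)) \<le> j"
          unfolding j by simp
      qed (use kpos[OF i] kn s in auto)
    qed
  next
    fix C :: real
    assume C: "C \<ge> 2" and j: "j = r * real s * log C (C * exp 1 * real s)"
      and n: "real n \<ge> Max ((\<lambda>i. C * exp 1 * real s * real (k i)) ` {1..s})"
    show ?thesis
    proof (rule junta[where \<beta> = "\<lambda>_. 1 / real s", OF sum_inv])
      fix i assume i: "i \<in> {1..s}"
      have n': "C * exp 1 * real s * real (k i) \<le> real n"
        using n i by (subst (asm) Max_le_iff) auto
      \<comment> \<open>Each of \<open>C\<close>, \<open>exp 1\<close> and \<open>s\<close> is at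
        least \<open>1\<close>, which yields \<open>k i \<le> n\<close>.\<close>
      have "1 * 1 * 1 * real (k i) \<le> C * exp 1 * real s * real (k i)"
        using C s by (intro mult_mono) auto
      with n' have "k i \<le> n" by simp
      then show "real (card {F \<in> nsets {1..n} (k i). \<exists>t. j < real t \<and> 1 / real s * real t \<le> real (card (F \<inter> {1..t}))})
          \<le> (real (k i) / real n) powr r * real (n choose k i)"
        using card_exceeding_le_union[OF r _ kpos[OF i] _ C n'] s j by simp
    qed
  qed
qed

end
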